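(* Let $n=2^t r$, where $t$ is a nonnegative integer and $r$ is an odd composite number, and let $P_n$ be the path on vertices $1,\ldots,n$ (consecutive labels adjacent). Then for every integer $1\le a\le n-1$, $P_n$ has no Laplacian pretty good edge state transfer from $\{a,a+1\}$ to $\{n-a,n-a+1\}$.
   Context: For a graph $G$ with Laplacian $L_G=D_G-A_G$ and $U(t)=\exp(-\mathrm{i}tL_G)$, $G$ has Laplacian pretty good edge state transfer (Edge-LPGST) from the edge $\{a,b\}$ to the edge $\{c,d\}$ if for every $\epsilon>0$ there exist $\tau\in\mathbb{R}$ and $\gamma\in\mathbb{C}$ with $|\gamma|=1$ such that $\left|U(\tau)(\mathbf{e}_a-\mathbf{e}_b)-\gamma(\mathbf{e}_c-\mathbf{e}_d)\right|<\epsilon$, where $\mathbf{e}_u$ is the standard unit vector at vertex $u$.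
   Formalization: The two edges {a,a+1} and {n-a,n-a+1} are assumed to be different, which excludes only a = n/2; there they coincide and transfer holds trivially at time 0 with phase 1 (e.g. n = 18, a = 9), so the claim as worded fails. *)

theory Defs
  imports "HOL-Analysis.L2_Norm" "HOL-Computational_Algebra.Primes"
    "Jordan_Normal_Form.Matrix"
begin

text \<open>
  A simple graph on the vertices \<open>1, \<dots>, n\<close> is given by its edge set \<open>E :: nat set set\<close>, whose members
  are two-element subsets of \<open>{1..n}\<close>. Matrices and vectors are 0-based, so the index \<open>i < n\<close> belongs
  to the vertex \<open>Suc i\<close>.
\<close>

definition adjacency_mat :: "nat \<Rightarrow> nat set set \<Rightarrow> complex mat" where
  "adjacency_mat n E = mat n n (\<lambda>(i, j). if {Suc i, Suc j} \<in> E then 1 else 0)"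

definition degree_mat :: "nat \<Rightarrow> nat set set \<Rightarrow> complex mat" where
  "degree_mat n E =
     mat n n (\<lambda>(i, j). if i = j then of_nat (card {e \<in> E. Suc i \<in> e}) else 0)"

definition laplacian_mat :: "nat \<Rightarrow> nat set set \<Rightarrow> complex mat" where
  "laplacian_mat n E = degree_mat n E - adjacency_mat n E"

text \<open>The matrix exponential of a square matrix; its power series is summed entry by entry.\<close>

definition mat_exp :: "complex mat \<Rightarrow> complex mat" where
  "mat_exp A = mat (dim_row A) (dim_col A) (\<lambda>(i, j). \<Sum>k. (A ^\<^sub>m k) $$ (i, j) / fact k)"

definition transition_mat :: "nat \<Rightarrow> nat set set \<Rightarrow> real \<Rightarrow> complex mat" where
  "transition_mat n E t = mat_exp ((- \<i> * complex_of_real t) \<cdot>\<^sub>m laplacian_mat n E)"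

definition vertex_vec :: "nat \<Rightarrow> nat \<Rightarrow> complex vec" where
  "vertex_vec n u = unit_vec n (u - 1)"

definition euclid_norm :: "complex vec \<Rightarrow> real" where
  "euclid_norm v = L2_set (\<lambda>i. cmod (v $ i)) {..<dim_vec v}"

text \<open>
  Edge-LPGST from \<open>{a, b}\<close> to \<open>{c, d}\<close>. The order of the two endpoints of an edge is immaterial, because
  the sign it changes is absorbed by the phase \<open>\<gamma>\<close>.
\<close>

definition edge_lpgst :: "nat \<Rightarrow> nat set set \<Rightarrow> nat \<Rightarrow> nat \<Rightarrow> nat \<Rightarrow> nat \<Rightarrow> bool" where
  "edge_lpgst n E a b c d \<longleftrightarrow>
     (\<forall>\<epsilon>>0. \<exists>\<tau>::real. \<exists>\<gamma>::complex. cmod \<gamma> = 1 \<and>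
        euclid_norm (transition_mat n E \<tau> *\<^sub>v (vertex_vec n a - vertex_vec n b)
          - \<gamma> \<cdot>\<^sub>v (vertex_vec n c - vertex_vec n d)) < \<epsilon>)"

definition path_edges :: "nat \<Rightarrow> nat set set" where
  "path_edges n = {{i, i + 1} | i. 1 \<le> i \<and> i + 1 \<le> n}"

lemma mat_exp_zero: "mat_exp (0\<^sub>m n n) = 1\<^sub>m n"
proof (rule eq_matI)
  fix i j assume ij: "i < dim_row (1\<^sub>m n :: complex mat)" "j < dim_col (1\<^sub>m n :: complex mat)"
  have z: "((0\<^sub>m n n :: complex mat) ^\<^sub>m k) $$ (i, j) / fact k = (if k = 0 then 1\<^sub>m n $$ (i, j) else 0)" for k
    using ij by (cases k) auto
  show "mat_exp (0\<^sub>m n n) $$ (i, j) = 1\<^sub>m n $$ (i, j)"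
  proof -
    have "(\<lambda>k::nat. if k = 0 then 1\<^sub>m n $$ (i, j) else 0) sums (1\<^sub>m n $$ (i, j) :: complex)"
      using sums_single[of 0 "\<lambda>_. 1\<^sub>m n $$ (i, j) :: complex"] by simp
    then have "(\<Sum>k. ((0\<^sub>m n n :: complex mat) ^\<^sub>m k) $$ (i, j) / fact k) = 1\<^sub>m n $$ (i, j)"
      unfolding z by (rule sums_unique[symmetric])
    then show ?thesis using ij by (simp add: mat_exp_def)
  qed
qed (auto simp: mat_exp_def)

text \<open>
  Every edge has Edge-LPGST to itself, at time \<open>0\<close>. A claim that there is no Edge-LPGST therefore has
  to be about two different edges.
\<close>

lemma edge_lpgst_refl: "edge_lpgst n E a b a b"
proof -
  let ?v = "vertex_vec n a - vertex_vec n b"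
  have L: "laplacian_mat n E \<in> carrier_mat n n"
    by (simp add: laplacian_mat_def degree_mat_def adjacency_mat_def minus_mat_def)
  have v: "?v \<in> carrier_vec n" by (simp add: vertex_vec_def)
  have "0 \<cdot>\<^sub>m laplacian_mat n E = 0\<^sub>m n n" using L by (intro eq_matI) auto
  then have "transition_mat n E 0 = 1\<^sub>m n" by (simp add: transition_mat_def mat_exp_zero)
  then have "transition_mat n E 0 *\<^sub>v ?v - 1 \<cdot>\<^sub>v ?v = 0\<^sub>v n" using v by simp
  then have "euclid_norm (transition_mat n E 0 *\<^sub>v ?v - 1 \<cdot>\<^sub>v ?v) = 0"
    by (simp add: euclid_norm_def L2_set_def)
  then show ?thesis unfolding edge_lpgst_def
    by (intro allI impI exI[of _ 0] exI[of _ 1]) simp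
qed

end

theory Submission imports Defs "HOL-Analysis.Complex_Transcendental" begin

text \<open>
  The Laplacian of \<open>P\<^sub>n\<close> has eigenvalues \<open>\<theta>\<^sub>j = 2 - 2 cos (\<pi> j / n)\<close> with eigenvectors
  \<open>u \<mapsto> cos ((2 u - 1) \<pi> j / (2 n))\<close>. Pairing the transfer condition with the \<open>j\<close>-th eigenvector shows
  that \<open>exp (- \<i> \<tau> \<theta>\<^sub>j)\<close> is close to \<open>- (- 1)\<^sup>j \<gamma>\<close> for every \<open>j\<close> in the support of the edge, that is,
  whenever \<open>n\<close> does not divide \<open>a j\<close>. Hence \<open>exp (- \<i> \<tau> (\<theta>\<^sub>j\<^sub>+\<^sub>1 - \<theta>\<^sub>j))\<close> is close to \<open>- 1\<close> if \<open>j\<close> and \<open>j + 1\<close>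
  both lie in the support.

  For an odd prime \<open>p\<close> dividing \<open>n\<close> and \<open>x = n / p\<close>, the alternating sum over \<open>k < p\<close> of the differences
  \<open>\<theta>\<^sub>2\<^sub>+\<^sub>k\<^sub>x - \<theta>\<^sub>1\<^sub>+\<^sub>k\<^sub>x\<close> vanishes, so the corresponding product of phases is \<open>1\<close>; but it is also close to
  \<open>(- 1)\<^sup>p = - 1\<close>. Compositeness of \<open>r\<close> allows \<open>p\<close> to be chosen such that all these indices lie in the
  support: it suffices that \<open>x\<close> and \<open>n / gcd a n\<close> have a common divisor \<open>\<ge> 3\<close>.
\<close>

section \<open>Left eigenvectors under the entrywise matrix exponential\<close>

text \<open>Each entry of a product is a sum of \<open>n\<close> terms, so one more factor costs at
  most \<open>n * B\<close>. This crude bound lets the exponential series of the number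
  \<open>n * B\<close> dominate that of every entry.\<close>

lemma norm_pow_mat_entry_le:
  fixes A :: "complex mat"
  assumes A: "A \<in> carrier_mat n n" and B: "\<And>i j. i < n \<Longrightarrow> j < n \<Longrightarrow> cmod (A $$ (i, j)) \<le> B"
    and ij: "i < n" "j < n"
  shows "cmod ((A ^\<^sub>m k) $$ (i, j)) \<le> (real n * B) ^ k"
  using ij
proof (induction k arbitrary: i j)
  case 0
  then show ?case using A by auto
next
  case (Suc k)
  have nn: "0 \<le> B" using B[OF Suc.prems] norm_ge_zero order_trans by blast
  have "(A ^\<^sub>m Suc k) $$ (i, j) = (\<Sum>l<n. (A ^\<^sub>m k) $$ (i, l) * A $$ (l, j))"
    using A Suc.prems pow_carrier_mat[OF A, of k]
    by (auto simp: scalar_prod_def lessThan_atLeast0 intro!: sum.cong)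
  also have "cmod \<dots> \<le> (\<Sum>l<n. (real n * B) ^ k * B)"
    using Suc B nn by (intro sum_norm_le) (auto simp: norm_mult intro!: mult_mono)
  finally show ?case by (simp add: algebra_simps)
qed

lemma summable_mat_exp_entry:
  fixes A :: "complex mat"
  assumes A: "A \<in> carrier_mat n n" and ij: "i < n" "j < n"
  shows "summable (\<lambda>k. (A ^\<^sub>m k) $$ (i, j) / fact k)"
proof -
  define B where "B = (\<Sum>i<n. \<Sum>j<n. cmod (A $$ (i, j)))"
  have B: "cmod (A $$ (i, j)) \<le> B" if "i < n" "j < n" for i j
  proof -
    have "cmod (A $$ (i, j)) \<le> (\<Sum>j<n. cmod (A $$ (i, j)))"
      using that by (intro member_le_sum) auto
    also have "\<dots> \<le> B" unfolding B_def using that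
      by (intro member_le_sum[of i _ "\<lambda>i. \<Sum>j<n. cmod (A $$ (i, j))"]) (auto intro: sum_nonneg)
    finally show ?thesis .
  qed
  show ?thesis
  proof (rule summable_comparison_test')
    show "summable (\<lambda>k. (real n * B) ^ k /\<^sub>R fact k)"
      by (rule summable_exp_generic)
    show "norm ((A ^\<^sub>m k) $$ (i, j) / fact k) \<le> (real n * B) ^ k /\<^sub>R fact k" for k
      using norm_pow_mat_entry_le[OF A B ij, of k]
      by (simp add: norm_divide divide_simps)
  qed
qed

text \<open>Row vectors are used so that a pairing with \<open>U x\<close> can move \<open>U\<close>
  onto the eigenvector without any appeal to symmetry of \<open>U\<close>.\<close>

lemma pow_mat_left_eigen:
  fixes A :: "complex mat"
  assumes A: "A \<in> carrier_mat n n"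
    and ev: "\<And>j. j < n \<Longrightarrow> (\<Sum>i<n. v i * A $$ (i, j)) = \<mu> * v j"
    and j: "j < n"
  shows "(\<Sum>i<n. v i * (A ^\<^sub>m k) $$ (i, j)) = \<mu> ^ k * v j"
  using j
proof (induction k arbitrary: j)
  case 0
  then show ?case using A by (simp add: if_distrib[of "(*) _"] sum.delta cong: if_cong)
next
  case (Suc k)
  have "(\<Sum>i<n. v i * (A ^\<^sub>m Suc k) $$ (i, j))
      = (\<Sum>i<n. \<Sum>l<n. v i * (A ^\<^sub>m k) $$ (i, l) * A $$ (l, j))"
    using A Suc.prems pow_carrier_mat[OF A, of k]
    by (auto simp: scalar_prod_def lessThan_atLeast0 sum_distrib_left mult.assoc intro!: sum.cong)
  also have "\<dots> = (\<Sum>l<n. (\<Sum>i<n. v i * (A ^\<^sub>m k) $$ (i, l)) * A $$ (l, j))"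
    by (subst sum.swap) (simp add: sum_distrib_right)
  also have "\<dots> = \<mu> ^ k * (\<Sum>l<n. v l * A $$ (l, j))"
    using Suc.IH by (simp add: sum_distrib_left mult.assoc)
  finally show ?case using ev[OF Suc.prems] by (simp add: mult.assoc mult.left_commute)
qed

lemma mat_exp_left_eigen:
  fixes A :: "complex mat"
  assumes A: "A \<in> carrier_mat n n"
    and ev: "\<And>j. j < n \<Longrightarrow> (\<Sum>i<n. v i * A $$ (i, j)) = \<mu> * v j"
    and j: "j < n"
  shows "(\<Sum>i<n. v i * mat_exp A $$ (i, j)) = exp \<mu> * v j"
proof -
  have "(\<lambda>k. \<Sum>i<n. v i * ((A ^\<^sub>m k) $$ (i, j) / fact k)) sums
      (\<Sum>i<n. v i * (\<Sum>k. (A ^\<^sub>m k) $$ (i, j) / fact k))"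
    using summable_mat_exp_entry[OF A _ j] by (intro sums_sum sums_mult summable_sums) auto
  also have "(\<lambda>k. \<Sum>i<n. v i * ((A ^\<^sub>m k) $$ (i, j) / fact k))
      = (\<lambda>k. \<mu> ^ k /\<^sub>R fact k * v j)"
  proof
    fix k
    have "(\<Sum>i<n. v i * ((A ^\<^sub>m k) $$ (i, j) / fact k)) = (\<Sum>i<n. v i * (A ^\<^sub>m k) $$ (i, j)) / fact k"
      by (simp add: sum_divide_distrib)
    also have "\<dots> = \<mu> ^ k /\<^sub>R fact k * v j"
      using pow_mat_left_eigen[OF A ev j, of k] by (simp add: scaleR_conv_of_real divide_inverse)
    finally show "(\<Sum>i<n. v i * ((A ^\<^sub>m k) $$ (i, j) / fact k)) = \<mu> ^ k /\<^sub>R fact k * v j" .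
  qed
  finally have "(\<lambda>k. \<mu> ^ k /\<^sub>R fact k * v j) sums (\<Sum>i<n. v i * mat_exp A $$ (i, j))"
    using A j by (simp add: mat_exp_def)
  moreover have "(\<lambda>k. \<mu> ^ k /\<^sub>R fact k * v j) sums (exp \<mu> * v j)"
    by (intro sums_mult2 exp_converges)
  ultimately show ?thesis by (rule sums_unique2)
qed

section \<open>The path Laplacian and its eigenvectors\<close>

lemma path_edges_iff:
  "{Suc i, Suc j} \<in> path_edges n \<longleftrightarrow> (j = Suc i \<or> i = Suc j) \<and> i < n \<and> j < n"
  by (auto simp: path_edges_def doubleton_eq_iff)

lemma card_path_edges_at:
  assumes "i < n"
  shows "card {e \<in> path_edges n. Suc i \<in> e} = (if 0 < i then 1 else 0) + (if Suc i < n then 1 else 0)"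
proof -
  have "{e \<in> path_edges n. Suc i \<in> e}
      = (if 0 < i then {{i, Suc i}} else {}) \<union> (if Suc i < n then {{Suc i, Suc (Suc i)}} else {})"
    using assms by (auto simp: path_edges_def)
  then show ?thesis by (auto simp: doubleton_eq_iff)
qed

text \<open>The boundary conditions describe reflecting ends: a phantom neighbour carries the value
  of the endpoint, which offsets the missing unit of degree, so every vertex may be treated as
  having degree 2.\<close>

lemma laplacian_mat_path_left_mult:
  assumes l: "l < n" and v0: "v (- 1) = v 0" and vn: "v (int n) = v (int n - 1)"
  shows "(\<Sum>i<n. v (int i) * laplacian_mat n (path_edges n) $$ (i, l))
      = 2 * v (int l) - v (int l - 1) - v (int l + 1)"
proof -
  let ?d = "of_nat ((if 0 < l then 1 else 0) + (if Suc l < n then 1 else 0)) :: complex"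
  have "(\<Sum>i<n. v (int i) * laplacian_mat n (path_edges n) $$ (i, l))
      = (\<Sum>i<n. (if i = l then v (int i) * ?d else 0) - (if i = Suc l then v (int i) else 0)
           - (if Suc i = l then v (int i) else 0))"
    using l by (intro sum.cong refl)
      (auto simp: laplacian_mat_def degree_mat_def adjacency_mat_def card_path_edges_at path_edges_iff)
  also have "\<dots> = v (int l) * ?d - (if Suc l < n then v (int l + 1) else 0)
       - (\<Sum>i<n. if Suc i = l then v (int i) else 0)"
    using l by (simp add: sum_subtractf add.commute)
  also have "(\<Sum>i<n. if Suc i = l then v (int i) else 0) = (if 0 < l then v (int l - 1) else 0)"
    using l by (cases l) auto
  also have "v (int l) * ?d - (if Suc l < n then v (int l + 1) else 0)
       - (if 0 < l then v (int l - 1) else 0) = 2 * v (int l) - v (int l - 1) - v (int l + 1)"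
  proof -
    have "v (int l + 1) = v (int l)" if "\<not> Suc l < n"
    proof -
      have "n = Suc l" using that l by simp
      then show ?thesis using vn by (simp add: add.commute)
    qed
    moreover have "v (int l - 1) = v (int l)" if "\<not> 0 < l" using that v0 by simp
    ultimately show ?thesis by (auto simp: algebra_simps)
  qed
  finally show ?thesis .
qed

definition path_eigenval :: "nat \<Rightarrow> nat \<Rightarrow> real" where
  "path_eigenval n j = 2 - 2 * cos (pi * j / n)"

text \<open>
  With the index shifted to start at \<open>0\<close>, and extended to all integers so that the eigenvalue equation
  has the same form at the two ends of the path as in its interior.
\<close>

definition path_eigenvec :: "nat \<Rightarrow> nat \<Rightarrow> int \<Rightarrow> real" where
  "path_eigenvec n j s = cos ((2 * of_int s + 1) * (pi * j / (2 * n)))"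

text \<open>At the left end the two angles are opposite; at the right end they are
  \<open>pi * j + \<phi>\<close> and \<open>pi * j - \<phi>\<close>. Cosine is invariant under both
  reflections.\<close>

lemma path_eigenvec_boundary:
  assumes "n > 0"
  shows "path_eigenvec n j (- 1) = path_eigenvec n j 0"
    "path_eigenvec n j (int n) = path_eigenvec n j (int n - 1)"
proof -
  show "path_eigenvec n j (- 1) = path_eigenvec n j 0" by (simp add: path_eigenvec_def)
  define \<phi> where "\<phi> = pi * j / (2 * n)"
  have "(2 * real n + 1) * \<phi> = pi * real j + \<phi>" "(2 * (real n - 1) + 1) * \<phi> = pi * real j - \<phi>"
    using assms by (auto simp: \<phi>_def field_simps)
  then show "path_eigenvec n j (int n) = path_eigenvec n j (int n - 1)"
    unfolding path_eigenvec_def \<phi>_def[symmetric]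
    by (simp only: of_int_of_nat_eq of_int_diff of_int_1)
      (simp add: cos_add cos_diff mult.commute[of pi])
qed

lemma path_eigenvec_step:
  assumes "n > 0"
  shows "2 * path_eigenvec n j s - path_eigenvec n j (s - 1) - path_eigenvec n j (s + 1)
      = path_eigenval n j * path_eigenvec n j s"
proof -
  define \<phi> where "\<phi> = pi * j / (2 * n)"
  have e: "pi * j / n = 2 * \<phi>" by (simp add: \<phi>_def)
  have "(2 * of_int (s - 1) + 1) * \<phi> = (2 * of_int s + 1) * \<phi> - 2 * \<phi>"
    "(2 * of_int (s + 1) + 1) * \<phi> = (2 * of_int s + 1) * \<phi> + 2 * \<phi>"
    by (simp_all add: algebra_simps)
  then show ?thesis
    unfolding path_eigenvec_def path_eigenval_def \<phi>_def[symmetric] e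
    by (simp only: cos_add cos_diff) (simp add: algebra_simps)
qed

lemma transition_mat_path_left_eigen:
  assumes l: "l < n"
  shows "(\<Sum>i<n. complex_of_real (path_eigenvec n j (int i))
            * transition_mat n (path_edges n) \<tau> $$ (i, l))
      = exp (- \<i> * \<tau> * path_eigenval n j) * path_eigenvec n j (int l)"
  unfolding transition_mat_def
proof (rule mat_exp_left_eigen)
  have L: "laplacian_mat n (path_edges n) \<in> carrier_mat n n"
    by (simp add: laplacian_mat_def degree_mat_def adjacency_mat_def minus_mat_def)
  then show "- \<i> * complex_of_real \<tau> \<cdot>\<^sub>m laplacian_mat n (path_edges n) \<in> carrier_mat n n" by simp
  fix l assume l: "l < n"
  let ?v = "\<lambda>s. complex_of_real (path_eigenvec n j s)"
  have "(\<Sum>i<n. ?v (int i) * (- \<i> * complex_of_real \<tau> \<cdot>\<^sub>m laplacian_mat n (path_edges n)) $$ (i, l))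
      = - \<i> * \<tau> * (\<Sum>i<n. ?v (int i) * laplacian_mat n (path_edges n) $$ (i, l))"
    using L l by (auto simp: sum_distrib_left mult_ac intro!: sum.cong)
  also have "(\<Sum>i<n. ?v (int i) * laplacian_mat n (path_edges n) $$ (i, l))
      = 2 * ?v (int l) - ?v (int l - 1) - ?v (int l + 1)"
    using l path_eigenvec_boundary[of n j]
    by (intro laplacian_mat_path_left_mult[where v = ?v]) auto
  also have "\<dots> = path_eigenval n j * ?v (int l)"
    using arg_cong[OF path_eigenvec_step[of n j "int l"], of complex_of_real] l by simp
  finally show "(\<Sum>i<n. ?v (int i) * (- \<i> * complex_of_real \<tau> \<cdot>\<^sub>m laplacian_mat n (path_edges n)) $$ (i, l))
      = - \<i> * \<tau> * path_eigenval n j * ?v (int l)" by (simp add: mult.assoc)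
qed (use l in simp)

section \<open>Pairing edge vectors with eigenvectors\<close>

text \<open>The pairing of the edge vector at \<open>a\<close>, \<open>a + 1\<close> with the
  \<open>j\<close>-th eigenvector, in a product form that exposes its zeros.\<close>

definition edge_coeff :: "nat \<Rightarrow> nat \<Rightarrow> nat \<Rightarrow> real" where
  "edge_coeff n j a = 2 * sin (pi * (a * j) / n) * sin (pi * j / (2 * n))"

lemma path_eigenvec_edge:
  assumes "1 \<le> a"
  shows "path_eigenvec n j (int (a - 1)) - path_eigenvec n j (int a) = edge_coeff n j a"
proof (cases "n = 0")
  case False
  define \<phi> where "\<phi> = pi * j / (2 * n)"
  define \<psi> where "\<psi> = pi * (a * j) / n"
  have "(2 * of_int (int (a - 1)) + 1) * \<phi> = \<psi> - \<phi>" "(2 * of_int (int a) + 1) * \<phi> = \<psi> + \<phi>"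
    using assms False by (auto simp: \<phi>_def \<psi>_def field_simps of_nat_diff)
  then show ?thesis
    unfolding path_eigenvec_def edge_coeff_def \<phi>_def[symmetric] \<psi>_def[symmetric]
    by (simp only: cos_add cos_diff)
\<comment> \<open>For \<open>n = 0\<close> division yields 0, so both cosines are 1 and both sines
  are 0.\<close>
qed (simp add: path_eigenvec_def edge_coeff_def)

text \<open>Reflection replaces the angle \<open>\<psi>\<close> by \<open>pi * j - \<psi>\<close>;
  this is the source of the sign \<open>(- 1) ^ j\<close> in the phases.\<close>

lemma edge_coeff_reflect:
  assumes "n > 0" "a \<le> n"
  shows "edge_coeff n j (n - a) = - ((- 1) ^ j) * edge_coeff n j a"
proof -
  define \<psi> where "\<psi> = pi * (a * j) / n"
  have "pi * ((n - a) * j) / n = pi * real j - \<psi>"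
    using assms by (auto simp: \<psi>_def field_simps of_nat_diff)
  then have "sin (pi * ((n - a) * j) / n) = - ((- 1) ^ j) * sin \<psi>"
    by (simp add: sin_diff mult.commute[of pi])
  then show ?thesis unfolding edge_coeff_def \<psi>_def by (simp add: algebra_simps)
qed

text \<open>The first sine vanishes only if \<open>a * j / n\<close> is an integer; the angle of the
  second lies strictly between 0 and \<open>pi / 2\<close>.\<close>

lemma edge_coeff_nonzero:
  assumes "0 < j" "j < n" "\<not> n dvd a * j"
  shows "edge_coeff n j a \<noteq> 0"
proof -
  have "sin (pi * (a * j) / n) \<noteq> 0"
  proof
    assume "sin (pi * (a * j) / n) = 0"
    then obtain i :: int where "pi * (a * j) / n = of_int i * pi" by (auto simp: sin_zero_iff_int2)
    then have "real (a * j) = of_int i * real n" using assms by (simp add: field_simps)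
    then have "of_int (int (a * j)) = (of_int (i * int n) :: real)" by simp
    then have "int (a * j) = i * int n" by (simp only: of_int_eq_iff)
    then have "int n dvd int (a * j)" by simp
    then show False using assms(3) by (simp only: int_dvd_int_iff)
  qed
  moreover have "sin (pi * j / (2 * n)) > 0"
    using assms by (intro sin_gt_zero) (auto simp: field_simps)
  ultimately show ?thesis by (simp add: edge_coeff_def)
qed

lemma norm_sum_le_euclid_norm:
  assumes F: "F \<in> carrier_vec n" and v: "\<And>i. i < n \<Longrightarrow> \<bar>v i\<bar> \<le> 1"
  shows "cmod (\<Sum>i<n. complex_of_real (v i) * F $ i) \<le> n * euclid_norm F"
proof -
  have "cmod (\<Sum>i<n. complex_of_real (v i) * F $ i) \<le> (\<Sum>i<n. euclid_norm F)"
  proof (rule sum_norm_le)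
    fix i assume i: "i \<in> {..<n}"
    have "cmod (complex_of_real (v i) * F $ i) \<le> cmod (F $ i)"
      using i v[of i] by (auto simp: norm_mult intro: mult_left_le_one_le)
    also have "\<dots> \<le> euclid_norm F" unfolding euclid_norm_def
      using i F by (intro member_le_L2_set) auto
    finally show "cmod (complex_of_real (v i) * F $ i) \<le> euclid_norm F" .
  qed
  then show ?thesis by simp
qed

lemma sum_mult_edge_vec:
  fixes c :: "nat \<Rightarrow> complex"
  assumes "1 \<le> a" "a < n"
  shows "(\<Sum>i<n. c i * (vertex_vec n a - vertex_vec n (a + 1)) $ i) = c (a - 1) - c a"
proof -
  have "(\<Sum>i<n. c i * (vertex_vec n a - vertex_vec n (a + 1)) $ i)
     = (\<Sum>i<n. (if i = a - 1 then c i else 0) - (if i = a then c i else 0))"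
    using assms by (intro sum.cong refl) (auto simp: vertex_vec_def unit_vec_def)
  then show ?thesis using assms by (simp add: sum_subtractf)
qed

section \<open>From edge transfer to limits of phases\<close>

text \<open>Pairing the error vector with the \<open>j\<close>-th eigenvector turns the transition
  matrix into a scalar phase, and reflection makes \<open>edge_coeff n j a\<close> a common factor.
  The factor \<open>n\<close> appears because the eigenvector is not normalised; its entries are at
  most 1 in modulus.\<close>

lemma edge_transfer_eigen_bound:
  assumes a: "1 \<le> a" "a < n" and \<gamma>: "cmod \<gamma> = 1"
    and small: "euclid_norm (transition_mat n (path_edges n) \<tau> *\<^sub>v (vertex_vec n a - vertex_vec n (a + 1))
          - \<gamma> \<cdot>\<^sub>v (vertex_vec n (n - a) - vertex_vec n (n - a + 1))) < \<epsilon>"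
  shows "\<bar>edge_coeff n j a\<bar> * cmod (exp (- \<i> * \<tau> * path_eigenval n j) + (- 1) ^ j * \<gamma>) \<le> n * \<epsilon>"
proof -
  let ?U = "transition_mat n (path_edges n) \<tau>"
  let ?x = "vertex_vec n a - vertex_vec n (a + 1)"
  let ?y = "vertex_vec n (n - a) - vertex_vec n (n - a + 1)"
  let ?v = "\<lambda>i. complex_of_real (path_eigenvec n j (int i))"
  let ?e = "exp (- \<i> * \<tau> * path_eigenval n j)"
  define F where "F = ?U *\<^sub>v ?x - \<gamma> \<cdot>\<^sub>v ?y"
  have U: "?U \<in> carrier_mat n n"
    by (auto simp: transition_mat_def mat_exp_def laplacian_mat_def degree_mat_def adjacency_mat_def)
  have x: "?x \<in> carrier_vec n" and y: "?y \<in> carrier_vec n" by (simp_all add: vertex_vec_def)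
  have F: "F \<in> carrier_vec n" using U x y by (simp add: F_def)
  have co: "?v (b - 1) - ?v b = edge_coeff n j b" if "1 \<le> b" for b
    using path_eigenvec_edge[OF that, of n j] by (simp flip: of_real_diff)
  have "(\<Sum>i<n. ?v i * F $ i)
      = (\<Sum>i<n. ?v i * (\<Sum>l<n. ?U $$ (i, l) * ?x $ l)) - \<gamma> * (\<Sum>i<n. ?v i * ?y $ i)"
    unfolding F_def sum_distrib_left[of \<gamma>] sum_subtractf[symmetric]
  proof (rule sum.cong[OF refl])
    fix i assume "i \<in> {..<n}"
    then have i: "i < n" by simp
    have "(?U *\<^sub>v ?x) $ i = (\<Sum>l<n. ?U $$ (i, l) * ?x $ l)"
      using U i by (auto simp: scalar_prod_def lessThan_atLeast0 vertex_vec_def intro!: sum.cong)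
    moreover have "(?U *\<^sub>v ?x - \<gamma> \<cdot>\<^sub>v ?y) $ i = (?U *\<^sub>v ?x) $ i - \<gamma> * ?y $ i"
      using i by (simp add: vertex_vec_def)
    ultimately show "?v i * (?U *\<^sub>v ?x - \<gamma> \<cdot>\<^sub>v ?y) $ i
        = ?v i * (\<Sum>l<n. ?U $$ (i, l) * ?x $ l) - \<gamma> * (?v i * ?y $ i)"
      by (simp only: right_diff_distrib mult.left_commute)
  qed
  also have "(\<Sum>i<n. ?v i * (\<Sum>l<n. ?U $$ (i, l) * ?x $ l))
      = (\<Sum>l<n. (\<Sum>i<n. ?v i * ?U $$ (i, l)) * ?x $ l)"
    by (simp only: sum_distrib_left sum_distrib_right mult.assoc) (rule sum.swap)
  also have "\<dots> = (\<Sum>l<n. (?e * ?v l) * ?x $ l)"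
    by (intro sum.cong refl) (simp only: lessThan_iff transition_mat_path_left_eigen)
  also have "\<dots> = ?e * edge_coeff n j a"
    unfolding sum_mult_edge_vec[OF a, where c = "\<lambda>l. ?e * ?v l"] right_diff_distrib[symmetric] co[OF a(1)] ..
  also have "(\<Sum>i<n. ?v i * ?y $ i) = edge_coeff n j (n - a)"
    using a co[of "n - a"] by (subst sum_mult_edge_vec) (auto simp del: diff_diff_left)
  also have "?e * edge_coeff n j a - \<gamma> * edge_coeff n j (n - a)
      = edge_coeff n j a * (?e + (- 1) ^ j * \<gamma>)"
    using edge_coeff_reflect[of n a j] a by (simp add: algebra_simps)
  finally have "cmod (\<Sum>i<n. ?v i * F $ i) = \<bar>edge_coeff n j a\<bar> * cmod (?e + (- 1) ^ j * \<gamma>)"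
    by (simp add: norm_mult)
  moreover have "cmod (\<Sum>i<n. ?v i * F $ i) \<le> n * euclid_norm F"
    by (rule norm_sum_le_euclid_norm[OF F]) (simp add: path_eigenvec_def)
  moreover have "\<dots> \<le> n * \<epsilon>" using small by (intro mult_left_mono) (auto simp: F_def)
  ultimately show ?thesis by linarith
qed

text \<open>Tolerances \<open>1 / (N + 1)\<close> give one sequence of times that serves all
  \<open>j\<close> at once. Differences of consecutive eigenvalues eliminate the phases
  \<open>\<Gamma> N\<close>, about whose convergence nothing is known.\<close>

lemma edge_lpgst_path_imp_phases:
  assumes a: "1 \<le> a" "a < n" and tr: "edge_lpgst n (path_edges n) a (a + 1) (n - a) (n - a + 1)"
  obtains T :: "nat \<Rightarrow> real" where
    "\<And>j. 0 < j \<Longrightarrow> Suc j < n \<Longrightarrow> \<not> n dvd a * j \<Longrightarrow> \<not> n dvd a * Suc j \<Longrightarrow>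
       (\<lambda>N. exp (- \<i> * T N * (path_eigenval n (Suc j) - path_eigenval n j))) \<longlonglongrightarrow> - 1"
proof -
  have "\<forall>N. \<exists>\<tau> \<gamma>. cmod \<gamma> = 1 \<and>
      euclid_norm (transition_mat n (path_edges n) \<tau> *\<^sub>v (vertex_vec n a - vertex_vec n (a + 1))
        - \<gamma> \<cdot>\<^sub>v (vertex_vec n (n - a) - vertex_vec n (n - a + 1))) < inverse (real (Suc N))"
    using tr unfolding edge_lpgst_def by (metis inverse_positive_iff_positive of_nat_0_less_iff zero_less_Suc)
  then obtain T \<Gamma> where \<Gamma>: "\<And>N. cmod (\<Gamma> N) = 1" and
    sm: "\<And>N. euclid_norm (transition_mat n (path_edges n) (T N) *\<^sub>v (vertex_vec n a - vertex_vec n (a + 1))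
        - \<Gamma> N \<cdot>\<^sub>v (vertex_vec n (n - a) - vertex_vec n (n - a + 1))) < inverse (real (Suc N))"
    by metis
  define E where "E j N = exp (- \<i> * T N * path_eigenval n j)" for j N
  have E1: "cmod (E j N) = 1" for j N by (simp add: E_def)
  have lim: "(\<lambda>N. E j N + (- 1) ^ j * \<Gamma> N) \<longlonglongrightarrow> 0" if j: "0 < j" "j < n" "\<not> n dvd a * j" for j
  proof (rule Lim_null_comparison)
    let ?c = "\<bar>edge_coeff n j a\<bar>"
    have c: "?c > 0" using edge_coeff_nonzero[OF j] by simp
    show "\<forall>\<^sub>F N in sequentially. cmod (E j N + (- 1) ^ j * \<Gamma> N) \<le> n / ?c * inverse (real (Suc N))"
    proof (rule always_eventually, rule allI)
      fix N
      have "?c * cmod (E j N + (- 1) ^ j * \<Gamma> N) \<le> n * inverse (real (Suc N))"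
        unfolding E_def by (rule edge_transfer_eigen_bound[OF a \<Gamma> sm])
      then show "cmod (E j N + (- 1) ^ j * \<Gamma> N) \<le> n / ?c * inverse (real (Suc N))"
        using pos_le_divide_eq[OF c] by (simp add: mult.commute)
    qed
    show "(\<lambda>N. n / ?c * inverse (real (Suc N))) \<longlonglongrightarrow> 0"
      by (intro tendsto_mult_right_zero LIMSEQ_inverse_real_of_nat)
  qed
  show thesis
  proof (rule that[of T])
    fix j assume j: "0 < j" "Suc j < n" "\<not> n dvd a * j" "\<not> n dvd a * Suc j"
    have "(\<lambda>N. (E (Suc j) N + (- 1) ^ Suc j * \<Gamma> N) + (E j N + (- 1) ^ j * \<Gamma> N)) \<longlonglongrightarrow> 0 + 0"
      using j by (intro tendsto_add lim) auto
    \<comment> \<open>Consecutive powers of -1 are opposite, so the two terms with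
      \<open>\<Gamma> N\<close> cancel.\<close>
    then have s: "(\<lambda>N. E (Suc j) N + E j N) \<longlonglongrightarrow> 0" by (simp add: algebra_simps)
    have "(\<lambda>N. E (Suc j) N / E j N + 1) \<longlonglongrightarrow> 0"
    proof (rule Lim_null_comparison[OF always_eventually tendsto_norm_zero[OF s]], rule allI)
      fix N
      have "E j N \<noteq> 0" by (simp add: E_def)
      then have "E (Suc j) N / E j N + 1 = (E (Suc j) N + E j N) / E j N" by (simp add: field_simps)
      then show "norm (E (Suc j) N / E j N + 1) \<le> norm (E (Suc j) N + E j N)"
        by (simp add: norm_divide E1)
    qed
    then have "(\<lambda>N. E (Suc j) N / E j N) \<longlonglongrightarrow> - 1"
      using tendsto_add[of "\<lambda>N. E (Suc j) N / E j N + 1" 0 sequentially "\<lambda>_. -1" "-1"] by simp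
    moreover have "E (Suc j) N / E j N = exp (- \<i> * T N * (path_eigenval n (Suc j) - path_eigenval n j))" for N
      by (simp add: E_def algebra_simps flip: exp_diff)
    ultimately show "(\<lambda>N. exp (- \<i> * T N * (path_eigenval n (Suc j) - path_eigenval n j))) \<longlonglongrightarrow> - 1"
      by simp
  qed
qed

section \<open>Vanishing alternating sums\<close>

text \<open>The summands are the real parts of \<open>cis \<alpha> * w ^ k\<close> with
  \<open>w = - cis (pi / p)\<close>. Oddness of \<open>p\<close> gives \<open>w ^ p = 1\<close>, so
  a full geometric sum over a root of unity vanishes.\<close>

lemma alternating_cos_sum:
  assumes "odd p" "p > 1"
  shows "(\<Sum>k<p. (- 1) ^ k * cos (\<alpha> + pi * k / p)) = 0"
proof -
  define w where "w = - cis (pi / p)"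
  have "w \<noteq> 1"
  proof
    assume "w = 1"
    then have "sin (pi / p) = 0" by (simp add: w_def complex_eq_iff)
    moreover have "sin (pi / p) > 0" using assms by (intro sin_gt_zero) (auto simp: field_simps)
    ultimately show False by simp
  qed
  moreover have "w ^ p = 1" using assms by (simp add: w_def Complex.DeMoivre)
  ultimately have "(\<Sum>k<p. w ^ k) = 0" by (simp add: sum_gp_strict)
  then have "Re (\<Sum>k<p. cis \<alpha> * w ^ k) = 0" by (simp flip: sum_distrib_left)
  moreover have "Re (cis \<alpha> * w ^ k) = (- 1) ^ k * cos (\<alpha> + pi * k / p)" for k
  proof -
    have "w ^ k = (- 1) ^ k * cis (pi * k / p)"
      unfolding w_def power_minus[of "cis (pi / p)"] Complex.DeMoivre by (simp add: mult.commute)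
    then have "cis \<alpha> * w ^ k = complex_of_real ((- 1) ^ k) * cis (\<alpha> + pi * k / p)"
      by (simp add: cis_mult[symmetric])
    then show ?thesis by (simp only: Re_complex_of_real times_complex.sel Im_complex_of_real cis.sel)
  qed
  ultimately show ?thesis by simp
qed

text \<open>A step of \<open>x\<close> in the index adds \<open>pi / p\<close> to the angle, so each
  of the starting indices 1 and 2 yields an alternating cosine sum; the constants 2 cancel in the
  differences.\<close>

lemma alternating_path_eigenval_sum:
  assumes "odd p" "p > 1" "x > 0"
  shows "(\<Sum>k<p. (- 1) ^ k * (path_eigenval (p * x) (Suc (Suc (k * x))) - path_eigenval (p * x) (Suc (k * x)))) = 0"
proof -
  have c: "cos (pi * (b + k * x) / (p * x)) = cos (pi * b / (p * x) + pi * k / p)" for b k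
    using assms by (intro arg_cong[where f = cos]) (simp add: field_simps)
  have s: "(\<Sum>k<p. (- 1) ^ k * cos (pi * (b + k * x) / (p * x))) = 0" for b
    unfolding c using alternating_cos_sum[OF assms(1,2)] .
  have "(\<Sum>k<p. (- 1) ^ k * (path_eigenval (p * x) (2 + k * x) - path_eigenval (p * x) (1 + k * x)))
     = 2 * (\<Sum>k<p. (- 1) ^ k * cos (pi * (1 + k * x) / (p * x)))
       - 2 * (\<Sum>k<p. (- 1) ^ k * cos (pi * (2 + k * x) / (p * x)))"
    unfolding sum_distrib_left sum_subtractf[symmetric] path_eigenval_def
    by (intro sum.cong refl) (simp add: algebra_simps)
  then show ?thesis using s[of 1] s[of 2] by simp
qed

section \<open>Choice of the prime\<close>

text \<open>If \<open>r\<close> divides \<open>m\<close>, any prime \<open>p\<close> dividing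
  \<open>r\<close> will do, with \<open>D = r / p\<close>. Otherwise \<open>r\<close> shares a prime
  \<open>p\<close> with \<open>g\<close>, and \<open>D = m\<close> works because
  \<open>n / p = (g / p) * m\<close>.\<close>

lemma obtain_prime_common_divisor:
  fixes n r a g :: nat
  assumes n: "n = 2 ^ t * r" and r: "odd r" "r > 1" "\<not> prime r"
    and m: "n = g * m" "m \<ge> 3"
  obtains p D where "prime p" "odd p" "p dvd n" "D \<ge> 3" "D dvd m" "D dvd n div p"
proof (cases "r dvd m")
  case True
  obtain p where p: "prime p" "p dvd r" using r prime_factor_nat[of r] by auto
  then obtain D where D: "r = p * D" by blast
  have "odd D" using D r by simp
  \<comment> \<open>Compositeness enters here: \<open>D = 1\<close> would make \<open>r\<close> the
    prime \<open>p\<close>.\<close>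
  moreover have "D \<noteq> 1" using D p r by auto
  ultimately have "D \<ge> 3" by (cases D) presburger+
  moreover have "D dvd m" using True D by (metis dvd_mult_right)
  moreover have "n div p = 2 ^ t * D" using p by (simp add: n D prime_gt_0_nat)
  moreover have "odd p" using D r by simp
  ultimately show thesis using that p n by (metis dvd_mult dvd_triv_right)
next
  case False
  have "\<not> coprime r g"
    using False n m by (metis coprime_dvd_mult_right_iff dvd_triv_right)
  then have "gcd r g \<noteq> 1" by (simp add: coprime_iff_gcd_eq_1)
  then obtain p where "prime p" "p dvd gcd r g" using prime_factor_nat by blast
  then have p: "prime p" "p dvd r" "p dvd g" by auto
  obtain h where h: "g = p * h" using p by blast
  have "odd p" using p r by (meson dvd_trans)
  moreover have "n div p = h * m" using p by (simp add: m h prime_gt_0_nat)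
  ultimately show thesis using that[of p m] p m n by simp
qed

section \<open>Contradiction from a product of phases\<close>

theorem theorem3p5:
  fixes n t r a :: nat
  assumes "n = 2 ^ t * r"
    and "odd r" and "r > 1" and "\<not> prime r"
    and "1 \<le> a" and "a \<le> n - 1"
    and "{a, a + 1} \<noteq> {n - a, n - a + 1}"
  shows "\<not> edge_lpgst n (path_edges n) a (a + 1) (n - a) (n - a + 1)"
proof
  assume "edge_lpgst n (path_edges n) a (a + 1) (n - a) (n - a + 1)"
  moreover have n0: "n > 0" using assms by auto
  then have an: "a < n" using assms by auto
  ultimately obtain T :: "nat \<Rightarrow> real" where
    T: "\<And>j. 0 < j \<Longrightarrow> Suc j < n \<Longrightarrow> \<not> n dvd a * j \<Longrightarrow> \<not> n dvd a * Suc j \<Longrightarrow>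
       (\<lambda>N. exp (- \<i> * T N * (path_eigenval n (Suc j) - path_eigenval n j))) \<longlonglongrightarrow> - 1"
    using edge_lpgst_path_imp_phases assms by metis
  define g where "g = gcd a n"
  obtain m where m: "n = g * m" unfolding g_def by (meson dvdE gcd_dvd2)
  \<comment> \<open>Cancelling \<open>g\<close> from \<open>a = g * a'\<close> leaves
    \<open>m dvd a' * j\<close> with \<open>a'\<close> coprime to \<open>m\<close>.\<close>
  have m_dvd: "m dvd j" if "n dvd a * j" for j
  proof -
    obtain a' where a': "a = g * a'" unfolding g_def by (meson dvdE gcd_dvd1)
    have g0: "g > 0" using n0 m by auto
    have "g = g * gcd a' m" using gcd_mult_distrib_nat[of g a' m] a' m by (metis g_def)
    then have "coprime a' m" using g0 by (metis coprime_iff_gcd_eq_1 mult_cancel1 mult.right_neutral neq0_conv)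
    moreover have "m dvd a' * j" using that g0 unfolding m a' by (simp add: mult.assoc)
    ultimately show ?thesis by (metis coprime_commute coprime_dvd_mult_right_iff)
  qed
  \<comment> \<open>Here \<open>m = 1\<close> would make \<open>n\<close> divide \<open>a\<close>,
    and \<open>m = 2\<close> would give \<open>a = n / 2\<close>, the edge that is its own mirror
    image.\<close>
  have "m \<ge> 3"
  proof -
    have "g \<le> a" "g dvd a" using assms(5) by (auto simp: g_def intro: gcd_le1_nat)
    then have "m \<noteq> 0" "m \<noteq> 1" using m n0 an by auto
    moreover have "m \<noteq> 2"
    proof
      assume "m = 2"
      obtain b where b: "a = g * b" using \<open>g dvd a\<close> by blast
      have "b < 2" "b \<noteq> 0" using an m \<open>m = 2\<close> b assms(5) by auto
      then have "b = 1" by simp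
      then have "n - a = a" using b m \<open>m = 2\<close> by simp
      then show False using assms(7) by simp
    qed
    ultimately show ?thesis by simp
  qed
  with obtain_prime_common_divisor[OF assms(1-4) m] obtain p D where
    p: "prime p" "odd p" "p dvd n" and D: "D \<ge> 3" "D dvd m" "D dvd n div p" by metis
  define x where "x = n div p"
  have nx: "n = p * x" using p by (simp add: x_def)
  have x0: "x > 0" using nx n0 by auto
  have p1: "p > 1" using p prime_gt_1_nat by blast
  have "x \<ge> 3" using D x0 dvd_imp_le[of D x] by (simp add: x_def)
  \<comment> \<open>Since \<open>D\<close> divides \<open>x\<close>, these indices are congruent to
    1 or 2 modulo \<open>D \<ge> 3\<close>, hence not multiples of \<open>D\<close>, let alone of
    \<open>m\<close>.\<close>
  have supp: "\<not> n dvd a * (b + k * x)" if "0 < b" "b < 3" for b k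
  proof
    assume "n dvd a * (b + k * x)"
    then have "D dvd b + k * x" using m_dvd D(2) dvd_trans by blast
    then have "D dvd b" using D(3) unfolding x_def by (metis dvd_add_left_iff dvd_mult)
    then show False using that D(1) dvd_imp_le by force
  qed
  define \<delta> where "\<delta> k = path_eigenval n (Suc (Suc (k * x))) - path_eigenval n (Suc (k * x))" for k
  \<comment> \<open>The alternating sign sits in the exponent: for odd \<open>k\<close> it inverts
    the phase, and the limit -1 is its own inverse.\<close>
  define y where "y k N = exp (- \<i> * T N * complex_of_real ((- 1) ^ k * \<delta> k))" for k N
  have "(\<lambda>N. y k N) \<longlonglongrightarrow> - 1" if k: "k < p" for k
  proof -
    \<comment> \<open>As \<open>k * x + x \<le> n\<close>, the bound \<open>x \<ge> 3\<close> keeps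
      even the larger index \<open>k * x + 2\<close> below \<open>n\<close>.\<close>
    have "(k + 1) * x \<le> p * x" using k by (intro mult_right_mono) auto
    then have "Suc (Suc (k * x)) < n" using \<open>x \<ge> 3\<close> nx by simp
    then have lim: "(\<lambda>N. exp (- \<i> * T N * \<delta> k)) \<longlonglongrightarrow> - 1"
      using T[of "Suc (k * x)"] supp[of 1 k] supp[of 2 k] by (simp add: \<delta>_def)
    show ?thesis
    proof (cases "even k")
      case True
      then show ?thesis using lim by (simp add: y_def)
    next
      case False
      then have "y k N = inverse (exp (- \<i> * T N * \<delta> k))" for N
        by (simp add: y_def flip: exp_minus)
      then show ?thesis using tendsto_inverse[OF lim] by simp
    qed
  qed
  \<comment> \<open>The limit is -1 because \<open>p\<close> is odd, yet every product equals 1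
    because the exponents sum to 0.\<close>
  then have "(\<lambda>N. \<Prod>k<p. y k N) \<longlonglongrightarrow> (\<Prod>k<p. - 1)" by (intro tendsto_prod) auto
  moreover have "(\<Prod>k<p. y k N) = 1" for N
  proof -
    have "(\<Prod>k<p. y k N) = exp (- \<i> * T N * complex_of_real (\<Sum>k<p. (- 1) ^ k * \<delta> k))"
      unfolding y_def by (simp add: exp_sum sum_distrib_left)
    also have "(\<Sum>k<p. (- 1) ^ k * \<delta> k) = 0"
      unfolding \<delta>_def nx by (rule alternating_path_eigenval_sum[OF p(2) p1 x0])
    finally show ?thesis by simp
  qed
  ultimately show False using p(2) by (simp add: LIMSEQ_const_iff)
qed

end
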